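(* For all complex parameters $a,b,b'$ one has the inclusion of local solution spaces $$S_2(a,b,b',a,a;x,y)\ \supset\ (1-x)^{-b}(1-y)^{-b'}\,S\left(b,b',a;\ \frac{xy}{(1-x)(1-y)}\right)$$ near any point $(x,y)\in\mathbb C^2$ with $xy(1-x)(1-y)(1-x-y)\ne 0$. That is, if $u(t)$ is a local solution of the Gauss hypergeometric equation $E(b,b',a;t)$, then $(1-x)^{-b}(1-y)^{-b'}u\big(\tfrac{xy}{(1-x)(1-y)}\big)$ is a solution of the system $E_2(a,b,b',a,a;x,y)$.
   Context: $E(a,b,c;t)$ is the Gauss hypergeometric equation $[D_t(c-1+D_t)-t(a+D_t)(b+D_t)]u=0$, $D_t=t\,d/dt$; $S(a,b,c;t)$ denotes its space of local holomorphic solutions (off $t=0,1$). $E_2(a,b,b',c,c';x,y)$ is Appell's system $P_2z=Q_2z=0$, where, with $D=x\,\partial/\partial x$, $D'=y\,\partial/\partial y$, $P_2=D(c-1+D)-x(a+D+D')(b+D)$, $Q_2=D'(c'-1+D')-y(a+D+D')(b'+D')$. $S_2(a,b,b',c,c';x,y)$ is the space of its local holomorphic solutions at points off $xy(1-x)(1-y)(1-x-y)=0$. Fixed local branches of the power functions are used. *)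

theory Defs
  imports "HOL-Complex_Analysis.Complex_Analysis"
begin

definition euler_op :: "(complex \<Rightarrow> complex) \<Rightarrow> complex \<Rightarrow> complex" where
  "euler_op u = (\<lambda>t. t * deriv u t)"

text \<open>The differential operator \<open>D\<^sub>t (c - 1 + D\<^sub>t) - t (a + D\<^sub>t) (b + D\<^sub>t)\<close> of \<open>E(a,b,c;t)\<close>.\<close>

definition gauss_op ::
  "complex \<Rightarrow> complex \<Rightarrow> complex \<Rightarrow> (complex \<Rightarrow> complex) \<Rightarrow> complex \<Rightarrow> complex" where
  "gauss_op a b c u =
     (let v = (\<lambda>t. (c - 1) * u t + euler_op u t);
          w = (\<lambda>t. b * u t + euler_op u t)
      in (\<lambda>t. euler_op v t - t * (a * w t + euler_op w t)))"

text \<open>A local solution at \<open>t\<^sub>0\<close> is represented by a total function; only its germ at \<open>t\<^sub>0\<close>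
  is relevant.\<close>

definition gauss_solutions ::
  "complex \<Rightarrow> complex \<Rightarrow> complex \<Rightarrow> complex \<Rightarrow> (complex \<Rightarrow> complex) set" where
  "gauss_solutions a b c t\<^sub>0 =
     {u. \<exists>T. open T \<and> t\<^sub>0 \<in> T \<and> T \<subseteq> - {0, 1} \<and> u holomorphic_on T \<and>
             (\<forall>t\<in>T. gauss_op a b c u t = 0)}"

text \<open>Holomorphy in two complex variables: the Frechet derivative exists at every point and is
  complex linear.  It is meant for open \<open>W\<close>.\<close>

definition holomorphic2_on :: "(complex \<times> complex \<Rightarrow> complex) \<Rightarrow> (complex \<times> complex) set \<Rightarrow> bool" where
  "holomorphic2_on F W \<longleftrightarrow>
     (\<forall>p\<in>W. \<exists>A B. (F has_derivative (\<lambda>(h, k). A * h + B * k)) (at p))"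

definition euler_x :: "(complex \<times> complex \<Rightarrow> complex) \<Rightarrow> complex \<times> complex \<Rightarrow> complex" where
  "euler_x F = (\<lambda>(x, y). x * deriv (\<lambda>s. F (s, y)) x)"

definition euler_y :: "(complex \<times> complex \<Rightarrow> complex) \<Rightarrow> complex \<times> complex \<Rightarrow> complex" where
  "euler_y F = (\<lambda>(x, y). y * deriv (\<lambda>s. F (x, s)) y)"

text \<open>\<open>P\<^sub>2 = D (c - 1 + D) - x (a + D + D') (b + D)\<close> and
  \<open>Q\<^sub>2 = D' (c' - 1 + D') - y (a + D + D') (b' + D')\<close>.\<close>

definition appell_P2 ::
  "complex \<Rightarrow> complex \<Rightarrow> complex \<Rightarrow> (complex \<times> complex \<Rightarrow> complex) \<Rightarrow> complex \<times> complex \<Rightarrow> complex" where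
  "appell_P2 a b c F =
     (let G = (\<lambda>p. (c - 1) * F p + euler_x F p);
          H = (\<lambda>p. b * F p + euler_x F p)
      in (\<lambda>p. euler_x G p - fst p * (a * H p + euler_x H p + euler_y H p)))"

definition appell_Q2 ::
  "complex \<Rightarrow> complex \<Rightarrow> complex \<Rightarrow> (complex \<times> complex \<Rightarrow> complex) \<Rightarrow> complex \<times> complex \<Rightarrow> complex" where
  "appell_Q2 a b' c' F =
     (let G = (\<lambda>p. (c' - 1) * F p + euler_y F p);
          H = (\<lambda>p. b' * F p + euler_y F p)
      in (\<lambda>p. euler_y G p - snd p * (a * H p + euler_x H p + euler_y H p)))"

definition appell_regular :: "(complex \<times> complex) set" where
  "appell_regular = {(x, y). x * y * (1 - x) * (1 - y) * (1 - x - y) \<noteq> 0}"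

definition appell2_solutions ::
  "complex \<Rightarrow> complex \<Rightarrow> complex \<Rightarrow> complex \<Rightarrow> complex \<Rightarrow> complex \<times> complex
     \<Rightarrow> (complex \<times> complex \<Rightarrow> complex) set" where
  "appell2_solutions a b b' c c' p\<^sub>0 =
     {F. \<exists>W. open W \<and> p\<^sub>0 \<in> W \<and> W \<subseteq> appell_regular \<and> holomorphic2_on F W \<and>
             (\<forall>p\<in>W. appell_P2 a b c F p = 0 \<and> appell_Q2 a b' c' F p = 0)}"

text \<open>\<open>f\<close> is, near \<open>w\<^sub>0\<close>, a holomorphic branch of \<open>w \<mapsto> w\<^sup>s = exp (s log w)\<close>, given by some
  holomorphic branch \<open>L\<close> of the logarithm (not necessarily the principal one).\<close>

definition power_branch_at :: "complex \<Rightarrow> complex \<Rightarrow> (complex \<Rightarrow> complex) \<Rightarrow> bool" where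
  "power_branch_at s w\<^sub>0 f \<longleftrightarrow>
     (\<exists>N L. open N \<and> w\<^sub>0 \<in> N \<and> L holomorphic_on N \<and>
            (\<forall>w\<in>N. exp (L w) = w \<and> f w = exp (s * L w)))"

end

theory Submission
  imports Defs
begin

text \<open>
  Write \<open>\<theta> = t d/dt\<close>, \<open>t = x y / ((1 - x) (1 - y))\<close>, and let \<open>\<Phi>\<^bsub>b,b'\<^esub>\<close> be the map
  \<open>u \<mapsto> (1 - x)\<^bsup>-b\<^esup> (1 - y)\<^bsup>-b'\<^esup> u(t)\<close>.  Since \<open>D t = t / (1 - x)\<close> and
  \<open>(b + D) (1 - x)\<^bsup>-b\<^esup> = b (1 - x)\<^bsup>-b-1\<^esup>\<close>, the product rule gives a contiguity relation
  \<open>(b + D) \<Phi>\<^bsub>b,b'\<^esub> = \<Phi>\<^bsub>b+1,b'\<^esub> (b + \<theta>)\<close> (lemma \<open>euler_x_twisted_pullback\<close>), and symmetrically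
  for \<open>D'\<close>, \<open>b'\<close>.  Applying it repeatedly turns every term of \<open>P\<^sub>2 \<Phi>\<^bsub>b,b'\<^esub> u\<close> into a
  combination of \<open>u\<close>, \<open>\<theta>u\<close>, \<open>\<theta>\<^sup>2u\<close> at \<open>t\<close> with rational coefficients.  When \<open>c = a\<close> the parameter
  \<open>a\<close> enters only through \<open>(a - 1) \<theta>u\<close>, and the identity
  \<open>1 - t = (1 - x - y) / ((1 - x) (1 - y))\<close> makes the combination collapse to the Gauss operator:
  \<open>P\<^sub>2 \<Phi>\<^bsub>b,b'\<^esub> = \<Phi>\<^bsub>b,b'\<^esub> E(b,b',a)\<close> (lemma \<open>appell_P2_twisted_pullback\<close>).  Thus \<open>P\<^sub>2\<close> annihilates
  the image of every solution \<open>u\<close>.  Exchanging the two variables exchanges \<open>P\<^sub>2\<close> with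
  \<open>Q\<^sub>2\<close> and \<open>b\<close> with \<open>b'\<close>, and \<open>E(b,b',a)\<close> is symmetric in \<open>b, b'\<close>, so \<open>Q\<^sub>2\<close> annihilates it as
  well.
\<close>

section \<open>The Gauss operator as a polynomial in the Euler operator\<close>

lemma euler_op_holomorphic:
  assumes "open T" "u holomorphic_on T"
  shows "euler_op u holomorphic_on T"
  unfolding euler_op_def by (intro holomorphic_intros holomorphic_deriv assms)

lemma euler_op_lin:
  assumes "open T" "u holomorphic_on T" "t \<in> T"
  shows "euler_op (\<lambda>t. k * u t + euler_op u t) t = k * euler_op u t + euler_op (euler_op u) t"
proof -
  have "u field_differentiable at t" "euler_op u field_differentiable at t"
    using assms euler_op_holomorphic holomorphic_on_imp_differentiable_at by blast+
  then have "((\<lambda>t. k * u t + euler_op u t) has_field_derivative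
               (k * deriv u t + deriv (euler_op u) t)) (at t)"
    unfolding DERIV_deriv_iff_field_differentiable[symmetric]
    by (auto intro!: DERIV_add DERIV_cmult)
  from DERIV_imp_deriv[OF this] show ?thesis
    by (simp add: euler_op_def[of "\<lambda>t. k * u t + euler_op u t"] distrib_left
        euler_op_def[of "euler_op u"])
      (simp add: euler_op_def)
qed

lemma gauss_op_expand:
  assumes "open T" "u holomorphic_on T" "t \<in> T"
  shows "gauss_op a b c u t =
           (1 - t) * euler_op (euler_op u) t + (c - 1 - t * (a + b)) * euler_op u t - t * a * b * u t"
  unfolding gauss_op_def Let_def euler_op_lin[OF assms] by (simp add: algebra_simps)

lemma gauss_op_commute:
  assumes "open T" "u holomorphic_on T" "t \<in> T"
  shows "gauss_op a b c u t = gauss_op b a c u t"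
  by (simp add: gauss_op_expand[OF assms] algebra_simps)

section \<open>Branches of powers\<close>

text \<open>The differential equation \<open>w f' = s f\<close> is the only property of a branch of \<open>w\<^sup>s\<close> that the
  operators see; unlike the branch of the logarithm behind it, it is directly inherited
  by \<open>f w / w\<close> with exponent \<open>s - 1\<close>.\<close>

definition power_like_on :: "complex \<Rightarrow> complex set \<Rightarrow> (complex \<Rightarrow> complex) \<Rightarrow> bool" where
  "power_like_on s N f \<longleftrightarrow>
     open N \<and> (\<forall>w\<in>N. w \<noteq> 0 \<and> (f has_field_derivative s * f w / w) (at w))"

lemma power_branch_at_imp_power_like_on:
  assumes "power_branch_at s w\<^sub>0 f"
  obtains N where "w\<^sub>0 \<in> N" "power_like_on s N f"
proof -
  from assms obtain N L where N: "open N" "w\<^sub>0 \<in> N" "L holomorphic_on N"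
    and L: "\<And>w. w \<in> N \<Longrightarrow> exp (L w) = w" and f: "\<And>w. w \<in> N \<Longrightarrow> f w = exp (s * L w)"
    unfolding power_branch_at_def by blast
  have "w \<noteq> 0 \<and> (f has_field_derivative s * f w / w) (at w)" if w: "w \<in> N" for w
  proof
    show "w \<noteq> 0"
      using L[OF w] by (metis exp_not_eq_zero)
    have dL: "(L has_field_derivative deriv L w) (at w)"
      using N w holomorphic_derivI by blast
    \<comment> \<open>Differentiating \<open>exp (L w) = w\<close> gives \<open>L' = 1 / w\<close>.\<close>
    have "((\<lambda>w. exp (L w)) has_field_derivative exp (L w) * deriv L w) (at w)"
      using dL by (auto intro!: derivative_eq_intros)
    moreover have "((\<lambda>w. exp (L w)) has_field_derivative 1) (at w)"
      by (rule has_field_derivative_transform_within_open[OF DERIV_ident N(1) w]) (simp add: L)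
    ultimately have L': "deriv L w = 1 / w"
      using DERIV_unique L[OF w] \<open>w \<noteq> 0\<close> by (fastforce simp: field_simps)
    have "((\<lambda>w. exp (s * L w)) has_field_derivative s * f w / w) (at w)"
      using dL by (auto intro!: derivative_eq_intros simp: L' f[OF w])
    then show "(f has_field_derivative s * f w / w) (at w)"
      by (rule has_field_derivative_transform_within_open[OF _ N(1) w]) (simp add: f)
  qed
  with N that show thesis
    unfolding power_like_on_def by blast
qed

lemma power_like_on_divide:
  assumes "power_like_on s N f"
  shows "power_like_on (s - 1) N (\<lambda>w. f w / w)"
  using assms unfolding power_like_on_def
  by (auto intro!: derivative_eq_intros simp: field_simps)

lemma power_like_on_holomorphic: "power_like_on s N f \<Longrightarrow> f holomorphic_on N"
  unfolding power_like_on_def holomorphic_on_def field_differentiable_def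
  using has_field_derivative_at_within by blast

section \<open>The twisted pullback\<close>

definition twisted_pullback ::
  "(complex \<Rightarrow> complex) \<Rightarrow> (complex \<Rightarrow> complex) \<Rightarrow> (complex \<Rightarrow> complex) \<Rightarrow> complex \<times> complex \<Rightarrow> complex"
  where "twisted_pullback f g u = (\<lambda>(x, y). f (1 - x) * g (1 - y) * u (x * y / ((1 - x) * (1 - y))))"

definition pullback_domain :: "complex set \<Rightarrow> complex set \<Rightarrow> complex set \<Rightarrow> (complex \<times> complex) set"
  where "pullback_domain N M T =
    {(x, y). 1 - x \<in> N \<and> 1 - y \<in> M \<and> x * y / ((1 - x) * (1 - y)) \<in> T}"

lemma twisted_pullback_swap: "twisted_pullback f g u (y, x) = twisted_pullback g f u (x, y)"
  by (simp add: twisted_pullback_def mult_ac)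

lemma pullback_domain_swap: "(y, x) \<in> pullback_domain N M T \<longleftrightarrow> (x, y) \<in> pullback_domain M N T"
  by (auto simp: pullback_domain_def mult_ac)

lemma open_pullback_domain:
  assumes "open N" "open M" "open T" "0 \<notin> N" "0 \<notin> M"
  shows "open (pullback_domain N M T)"
proof -
  let ?B = "(\<lambda>p. 1 - fst p) -` N \<inter> (\<lambda>p. 1 - snd p) -` M"
  let ?t = "\<lambda>p::complex \<times> complex. fst p * snd p / ((1 - fst p) * (1 - snd p))"
  have "open ?B"
    by (intro open_Int open_vimage assms continuous_intros)
  moreover have "continuous_on ?B ?t"
    using assms by (intro continuous_intros) auto
  ultimately have "open (?B \<inter> ?t -` T)"
    using assms(3) by (simp only: continuous_open_preimage)
  moreover have "?B \<inter> ?t -` T = pullback_domain N M T"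
    by (auto simp: pullback_domain_def)
  ultimately show ?thesis by simp
qed

section \<open>Partial Euler operators\<close>

lemma euler_y_eq_euler_x_swap: "euler_y F (x, y) = euler_x (\<lambda>(s, t). F (t, s)) (y, x)"
  by (simp add: euler_x_def euler_y_def)

lemma euler_x_cong:
  assumes "open W" "(x, y) \<in> W" "\<And>p. p \<in> W \<Longrightarrow> F p = G p"
  shows "euler_x F (x, y) = euler_x G (x, y)"
proof -
  have "open ((\<lambda>s. (s, y)) -` W)"
    by (intro open_vimage assms continuous_intros)
  then have "\<forall>\<^sub>F s in nhds x. s \<in> (\<lambda>s. (s, y)) -` W"
    by (rule eventually_nhds_in_open) (use assms in auto)
  then have "\<forall>\<^sub>F s in nhds x. F (s, y) = G (s, y)"
    by (rule eventually_mono) (use assms(3) in auto)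
  then show ?thesis
    by (auto simp: euler_x_def intro!: deriv_cong_ev)
qed

lemma euler_x_lin:
  assumes "(\<lambda>s. F (s, y)) field_differentiable at x" "(\<lambda>s. G (s, y)) field_differentiable at x"
  shows "euler_x (\<lambda>p. k * F p + G p) (x, y) = k * euler_x F (x, y) + euler_x G (x, y)"
proof -
  have "((\<lambda>s. k * F (s, y) + G (s, y)) has_field_derivative
          k * deriv (\<lambda>s. F (s, y)) x + deriv (\<lambda>s. G (s, y)) x) (at x)"
    using assms unfolding DERIV_deriv_iff_field_differentiable[symmetric]
    by (intro DERIV_add DERIV_cmult)
  from DERIV_imp_deriv[OF this] show ?thesis
    by (simp add: euler_x_def algebra_simps)
qed

lemma appell_Q2_eq_appell_P2_swap:
  "appell_Q2 a b' c' F (x, y) = appell_P2 a b' c' (\<lambda>(s, t). F (t, s)) (y, x)"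
  by (simp add: appell_P2_def appell_Q2_def Let_def euler_x_def euler_y_def)

section \<open>Contiguity relations and intertwining\<close>

lemma twisted_pullback_has_x_derivative:
  assumes "power_like_on (- b) N f" "power_like_on (- b') M g"
    and "open T" "u holomorphic_on T" "(x, y) \<in> pullback_domain N M T"
  shows "((\<lambda>s. twisted_pullback f g u (s, y)) has_field_derivative
           f (1 - x) * g (1 - y) / (1 - x) *
             (b * u (x * y / ((1 - x) * (1 - y)))
               + y / ((1 - x) * (1 - y)) * deriv u (x * y / ((1 - x) * (1 - y))))) (at x)"
proof -
  let ?t = "\<lambda>s. s * y / ((1 - s) * (1 - y))"
  have x: "1 - x \<in> N" and y: "1 - y \<in> M" and t: "?t x \<in> T"
    using assms(5) by (auto simp: pullback_domain_def)
  have nz: "1 - x \<noteq> 0" "1 - y \<noteq> 0"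
    using x y assms(1,2) by (auto simp: power_like_on_def)
  have f0: "(f has_field_derivative - b * f (1 - x) / (1 - x)) (at (1 - x))"
    using assms(1) x by (auto simp: power_like_on_def)
  have "((\<lambda>s. 1 - s) has_field_derivative - 1) (at x)"
    by (auto intro!: derivative_eq_intros)
  from DERIV_chain2[OF f0 this]
  have f': "((\<lambda>s. f (1 - s)) has_field_derivative b * f (1 - x) / (1 - x)) (at x)"
    by simp
  have "(?t has_field_derivative
          (y * ((1 - x) * (1 - y)) + x * y * (1 - y)) / ((1 - x) * (1 - y))\<^sup>2) (at x)"
    using nz by (auto intro!: derivative_eq_intros simp: power2_eq_square) (simp add: algebra_simps)
  moreover have "(y * ((1 - x) * (1 - y)) + x * y * (1 - y)) / ((1 - x) * (1 - y))\<^sup>2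
      = y / ((1 - x) * (1 - y)) / (1 - x)"
  proof -
    have "y * ((1 - x) * (1 - y)) + x * y * (1 - y) = y * (1 - y)"
      by (simp add: algebra_simps)
    with nz show ?thesis by (simp add: power2_eq_square)
  qed
  ultimately have t': "(?t has_field_derivative y / ((1 - x) * (1 - y)) / (1 - x)) (at x)"
    by simp
  have u0: "(u has_field_derivative deriv u (?t x)) (at (?t x))"
    using holomorphic_derivI[OF assms(4,3) t] .
  note u' = DERIV_chain2[OF u0 t']
  show ?thesis
    unfolding twisted_pullback_def case_prod_conv
    by (rule DERIV_cong[OF DERIV_mult[OF DERIV_mult[OF f' DERIV_const] u']])
      (simp add: distrib_left add_divide_distrib mult_ac)
qed

text \<open>The contiguity relation \<open>(b + D) \<Phi>\<^bsub>b,b'\<^esub> = \<Phi>\<^bsub>b+1,b'\<^esub> (b + \<theta>)\<close>: adding \<open>b\<close> turns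
  the logarithmic derivative \<open>b x / (1 - x)\<close> of the amplitude under \<open>D\<close> into \<open>b / (1 - x)\<close>, so that it
  acquires the same factor \<open>1 / (1 - x)\<close> that the chain rule produces from \<open>D t = t / (1 - x)\<close>.\<close>

lemma euler_x_twisted_pullback:
  assumes "power_like_on (- b) N f" "power_like_on (- b') M g"
    and "open T" "u holomorphic_on T" "(x, y) \<in> pullback_domain N M T"
  shows "b * twisted_pullback f g u (x, y) + euler_x (twisted_pullback f g u) (x, y) =
           twisted_pullback (\<lambda>w. f w / w) g (\<lambda>t. b * u t + euler_op u t) (x, y)"
proof -
  have nz: "1 - x \<noteq> 0" "1 - y \<noteq> 0"
    using assms(1,2,5) by (auto simp: power_like_on_def pullback_domain_def)
  define t where "t = x * y / ((1 - x) * (1 - y))"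
  have "euler_x (twisted_pullback f g u) (x, y) =
    f (1 - x) * g (1 - y) / (1 - x) * (x * b * u t + t * deriv u t)"
    using DERIV_imp_deriv[OF twisted_pullback_has_x_derivative[OF assms]]
    by (simp add: euler_x_def t_def algebra_simps)
  moreover have "twisted_pullback f g u (x, y) = f (1 - x) * g (1 - y) / (1 - x) * ((1 - x) * u t)"
    using nz by (simp add: twisted_pullback_def t_def)
  moreover have "twisted_pullback (\<lambda>w. f w / w) g (\<lambda>t. b * u t + euler_op u t) (x, y)
      = f (1 - x) * g (1 - y) / (1 - x) * (b * u t + t * deriv u t)"
    by (simp add: twisted_pullback_def t_def euler_op_def)
  ultimately show ?thesis
    by (simp only: distrib_left mult.left_commute[of b] flip: distrib_left)
      (simp add: algebra_simps)
qed

lemma euler_y_twisted_pullback: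
  assumes "power_like_on (- b) N f" "power_like_on (- b') M g"
    and "open T" "u holomorphic_on T" "(x, y) \<in> pullback_domain N M T"
  shows "b' * twisted_pullback f g u (x, y) + euler_y (twisted_pullback f g u) (x, y) =
           twisted_pullback f (\<lambda>w. g w / w) (\<lambda>t. b' * u t + euler_op u t) (x, y)"
proof -
  have "(\<lambda>(s, t). twisted_pullback f g u (t, s)) = twisted_pullback g f u"
    by (auto simp: twisted_pullback_swap)
  moreover have "(y, x) \<in> pullback_domain M N T"
    using assms(5) by (simp add: pullback_domain_swap)
  ultimately show ?thesis
    using euler_x_twisted_pullback[OF assms(2,1,3,4)]
    by (simp add: euler_y_eq_euler_x_swap twisted_pullback_swap)
qed

text \<open>The intertwining relation \<open>P\<^sub>2 \<Phi>\<^bsub>b,b'\<^esub> = \<Phi>\<^bsub>b,b'\<^esub> E(b,b',a)\<close>.  The last parameter of \<open>P\<^sub>2\<close>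
  equals its first because the terms carrying \<open>a\<close> and \<open>c\<close> are
  \<open>c D - x a (b + D)\<close>, whose image under \<open>\<Phi>\<^bsub>b,b'\<^esub>\<close> is
  \<open>\<Phi>\<^bsub>b+1,b'\<^esub> (c (b x + \<theta>) - a x (b + \<theta>))\<close>, and for \<open>c = a\<close> this is \<open>\<Phi>\<^bsub>b,b'\<^esub> (a \<theta>)\<close>.\<close>

lemma appell_P2_twisted_pullback:
  assumes f: "power_like_on (- b) N f" and g: "power_like_on (- b') M g"
    and T: "open T" "u holomorphic_on T" and p: "(x, y) \<in> pullback_domain N M T"
  shows "appell_P2 a b a (twisted_pullback f g u) (x, y) =
           twisted_pullback f g (gauss_op b b' a u) (x, y)"
proof -
  define F where "F = twisted_pullback f g u"
  define f1 where "f1 = (\<lambda>w. f w / w)"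
  define w where "w = (\<lambda>t. b * u t + euler_op u t)"
  define K where "K = twisted_pullback f1 g w"
  define t where "t = x * y / ((1 - x) * (1 - y))"
  have nz: "1 - x \<noteq> 0" "1 - y \<noteq> 0" and tT: "t \<in> T"
    using f g p by (auto simp: power_like_on_def pullback_domain_def t_def)
  have W: "open (pullback_domain N M T)"
    using f g T by (intro open_pullback_domain) (auto simp: power_like_on_def)
  have f1: "power_like_on (- (b + 1)) N f1"
    using power_like_on_divide[OF f] by (simp add: f1_def)
  have w: "w holomorphic_on T"
    unfolding w_def by (intro holomorphic_intros T euler_op_holomorphic)
  have HK: "b * F q + euler_x F q = K q" if "q \<in> pullback_domain N M T" for q
    using euler_x_twisted_pullback[OF f g T] that
    by (cases q) (simp add: F_def K_def f1_def w_def)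
  have "(\<lambda>s. F (s, y)) field_differentiable at x" "(\<lambda>s. K (s, y)) field_differentiable at x"
    using twisted_pullback_has_x_derivative[OF f g T p]
      twisted_pullback_has_x_derivative[OF f1 g T(1) w p]
    unfolding field_differentiable_def F_def K_def by blast+
  note lin = euler_x_lin[OF this]
  have G: "euler_x (\<lambda>p. (a - 1) * F p + euler_x F p) (x, y) =
      (a - 1 - b) * euler_x F (x, y) + euler_x K (x, y)"
  proof -
    have "(a - 1) * F q + euler_x F q = (a - 1 - b) * F q + K q"
      if "q \<in> pullback_domain N M T" for q
      using HK[OF that] by (simp add: algebra_simps)
    from euler_x_cong[OF W p this] show ?thesis by (simp add: lin)
  qed
  have H: "euler_x (\<lambda>p. b * F p + euler_x F p) (x, y) = euler_x K (x, y)"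
    by (rule euler_x_cong[OF W p HK])
  have H': "euler_y (\<lambda>p. b * F p + euler_x F p) (x, y) = euler_y K (x, y)"
    unfolding euler_y_eq_euler_x_swap
  proof (rule euler_x_cong)
    show "open (pullback_domain M N T)"
      using f g T by (intro open_pullback_domain) (auto simp: power_like_on_def)
    show "(y, x) \<in> pullback_domain M N T"
      using p by (simp add: pullback_domain_swap)
  qed (auto simp: HK pullback_domain_swap)
  \<comment> \<open>Each term of \<open>P\<^sub>2 F\<close> can now be written through \<open>u\<close>, \<open>\<theta>u\<close>, \<open>\<theta>\<^sup>2u\<close> at \<open>t\<close>; each use of the contiguity
    relation contributes one factor \<open>1 / (1 - x)\<close> or \<open>1 / (1 - y)\<close>.\<close>
  define A where "A = f (1 - x) * g (1 - y)"
  define u0 u1 u2 where "u0 = u t" "u1 = euler_op u t" "u2 = euler_op (euler_op u) t"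
  have F: "F (x, y) = A * u0"
    by (simp add: F_def twisted_pullback_def A_def u0_u1_u2_def t_def)
  have K: "K (x, y) = A / (1 - x) * (b * u0 + u1)"
    by (simp add: K_def twisted_pullback_def A_def u0_u1_u2_def t_def f1_def w_def)
  have dw: "euler_op w t = b * u1 + u2"
    using euler_op_lin[OF T tT] by (simp add: w_def u0_u1_u2_def)
  have DF: "euler_x F (x, y) = K (x, y) - b * F (x, y)"
    using HK[OF p] by (simp add: algebra_simps)
  have "(b + 1) * K (x, y) + euler_x K (x, y) =
      A / (1 - x) / (1 - x) * ((b + 1) * w t + euler_op w t)"
    using euler_x_twisted_pullback[OF f1 g T(1) w p]
    by (simp add: K_def) (simp add: twisted_pullback_def A_def t_def f1_def)
  then have DK: "euler_x K (x, y) =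
      A / (1 - x) / (1 - x) * ((b + 1) * (b * u0 + u1) + (b * u1 + u2)) - (b + 1) * K (x, y)"
    by (simp add: dw) (simp add: w_def u0_u1_u2_def algebra_simps)
  have "b' * K (x, y) + euler_y K (x, y) =
      A / (1 - x) / (1 - y) * (b' * w t + euler_op w t)"
    using euler_y_twisted_pullback[OF f1 g T(1) w p]
    by (simp add: K_def) (simp add: twisted_pullback_def A_def t_def f1_def)
  then have D'K: "euler_y K (x, y) =
      A / (1 - x) / (1 - y) * (b' * (b * u0 + u1) + (b * u1 + u2)) - b' * K (x, y)"
    by (simp add: dw) (simp add: w_def u0_u1_u2_def algebra_simps)
  have "appell_P2 a b a F (x, y) =
      (a - 1 - b) * euler_x F (x, y) + euler_x K (x, y)
        - x * (a * K (x, y) + euler_x K (x, y) + euler_y K (x, y))"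
    unfolding appell_P2_def Let_def by (simp add: G H H' HK[OF p])
  also have "\<dots> = A * ((1 - t) * u2 + (a - 1 - t * (b + b')) * u1 - t * b * b' * u0)"
  proof -
    \<comment> \<open>In terms of these inverses the claim is polynomial, since \<open>t\<close>, \<open>x i\<close> are polynomials in them.\<close>
    define i j where "i = 1 / (1 - x)" and "j = 1 / (1 - y)"
    have i: "x * i = i - 1"
      using nz by (simp add: i_def field_simps)
    have t: "t = (i - 1) * (j - 1)"
      using nz by (simp add: t_def i_def j_def field_simps)
    have Ki: "K (x, y) = A * i * (b * u0 + u1)"
      by (simp add: K i_def)
    have DKi: "euler_x K (x, y) =
        A * i * i * ((b + 1) * (b * u0 + u1) + (b * u1 + u2)) - (b + 1) * K (x, y)"
      by (simp add: DK i_def)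
    have D'Ki: "euler_y K (x, y) =
        A * i * j * (b' * (b * u0 + u1) + (b * u1 + u2)) - b' * K (x, y)"
      by (simp add: D'K i_def j_def)
    show ?thesis
      unfolding DF DKi D'Ki Ki F t using i by algebra
  qed
  also have "\<dots> = twisted_pullback f g (gauss_op b b' a u) (x, y)"
    by (simp add: twisted_pullback_def gauss_op_expand[OF T tT, unfolded t_def] A_def u0_u1_u2_def t_def)
  finally show ?thesis by (simp add: F_def)
qed

lemma appell_Q2_twisted_pullback:
  assumes f: "power_like_on (- b) N f" and g: "power_like_on (- b') M g"
    and T: "open T" "u holomorphic_on T" and p: "(x, y) \<in> pullback_domain N M T"
  shows "appell_Q2 a b' a (twisted_pullback f g u) (x, y) =
           twisted_pullback f g (gauss_op b b' a u) (x, y)"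
proof -
  have "(y, x) \<in> pullback_domain M N T"
    using p by (simp add: pullback_domain_swap)
  note P = appell_P2_twisted_pullback[OF g f T this]
  have "x * y / ((1 - x) * (1 - y)) \<in> T"
    using p by (simp add: pullback_domain_def)
  note sym = gauss_op_commute[OF T this]
  have "(\<lambda>(s, t). twisted_pullback f g u (t, s)) = twisted_pullback g f u"
    by (auto simp: twisted_pullback_swap)
  then have "appell_Q2 a b' a (twisted_pullback f g u) (x, y) =
      twisted_pullback f g (gauss_op b' b a u) (x, y)"
    by (simp add: appell_Q2_eq_appell_P2_swap P twisted_pullback_swap)
  also have "\<dots> = twisted_pullback f g (gauss_op b b' a u) (x, y)"
    by (simp add: twisted_pullback_def sym[of b' b])
  finally show ?thesis .
qed

section \<open>Holomorphy in two variables\<close>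

lemma holomorphic2_on_fst: "holomorphic2_on fst W"
proof -
  have "(fst has_derivative (\<lambda>(h, k). 1 * h + 0 * k)) (at p)" for p :: "complex \<times> complex"
    by (simp add: case_prod_unfold has_derivative_fst)
  then show ?thesis unfolding holomorphic2_on_def by blast
qed

lemma holomorphic2_on_snd: "holomorphic2_on snd W"
proof -
  have "(snd has_derivative (\<lambda>(h, k). 0 * h + 1 * k)) (at p)" for p :: "complex \<times> complex"
    by (simp add: case_prod_unfold has_derivative_snd)
  then show ?thesis unfolding holomorphic2_on_def by blast
qed

lemma holomorphic2_on_mult:
  assumes "holomorphic2_on F W" "holomorphic2_on G W"
  shows "holomorphic2_on (\<lambda>p. F p * G p) W"
  unfolding holomorphic2_on_def
proof
  fix p assume "p \<in> W"
  with assms obtain A B C D where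
    "(F has_derivative (\<lambda>(h, k). A * h + B * k)) (at p)"
    "(G has_derivative (\<lambda>(h, k). C * h + D * k)) (at p)"
    unfolding holomorphic2_on_def by meson
  from has_derivative_mult[OF this]
  have "((\<lambda>p. F p * G p) has_derivative
      (\<lambda>(h, k). (F p * C + A * G p) * h + (F p * D + B * G p) * k)) (at p)"
    by (rule has_derivative_eq_rhs) (auto simp: algebra_simps)
  then show "\<exists>A B. ((\<lambda>p. F p * G p) has_derivative (\<lambda>(h, k). A * h + B * k)) (at p)"
    by blast
qed

lemma holomorphic2_on_compose:
  assumes "holomorphic2_on F W" "v holomorphic_on S" "open S" "F ` W \<subseteq> S"
  shows "holomorphic2_on (\<lambda>p. v (F p)) W"
  unfolding holomorphic2_on_def
proof
  fix p assume p: "p \<in> W"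
  with assms obtain A B where F: "(F has_derivative (\<lambda>(h, k). A * h + B * k)) (at p)"
    unfolding holomorphic2_on_def by meson
  have "(v has_derivative (*) (deriv v (F p))) (at (F p))"
    using holomorphic_derivI[OF assms(2,3)] assms(4) p
    by (auto simp: has_field_derivative_def)
  from has_derivative_compose[OF F this]
  have "((\<lambda>p. v (F p)) has_derivative
      (\<lambda>(h, k). (deriv v (F p) * A) * h + (deriv v (F p) * B) * k)) (at p)"
    by (rule has_derivative_eq_rhs) (auto simp: algebra_simps)
  then show "\<exists>A B. ((\<lambda>p. v (F p)) has_derivative (\<lambda>(h, k). A * h + B * k)) (at p)"
    by blast
qed

lemma holomorphic2_on_twisted_pullback:
  assumes N: "open N" "0 \<notin> N" "f holomorphic_on N" and M: "open M" "0 \<notin> M" "g holomorphic_on M"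
    and T: "open T" "u holomorphic_on T"
  shows "holomorphic2_on (twisted_pullback f g u) (pullback_domain N M T)"
proof -
  let ?W = "pullback_domain N M T"
  let ?r = "\<lambda>z::complex. z / (1 - z)"
  have refl_open: "open ((\<lambda>z. 1 - z) -` S)" if "open S" for S :: "complex set"
    by (intro open_vimage that continuous_intros)
  have fst1: "holomorphic2_on (\<lambda>p. v (fst p)) ?W"
    if "v holomorphic_on (\<lambda>z. 1 - z) -` N" for v
    by (rule holomorphic2_on_compose[OF holomorphic2_on_fst that refl_open[OF N(1)]])
      (auto simp: pullback_domain_def)
  have snd1: "holomorphic2_on (\<lambda>p. v (snd p)) ?W"
    if "v holomorphic_on (\<lambda>z. 1 - z) -` M" for v
    by (rule holomorphic2_on_compose[OF holomorphic2_on_snd that refl_open[OF M(1)]])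
      (auto simp: pullback_domain_def)
  have f: "(\<lambda>z. f (1 - z)) holomorphic_on (\<lambda>z. 1 - z) -` N"
    by (rule holomorphic_on_compose_gen[OF _ N(3), unfolded o_def])
      (auto intro!: holomorphic_intros)
  have g: "(\<lambda>z. g (1 - z)) holomorphic_on (\<lambda>z. 1 - z) -` M"
    by (rule holomorphic_on_compose_gen[OF _ M(3), unfolded o_def])
      (auto intro!: holomorphic_intros)
  have r: "?r holomorphic_on (\<lambda>z. 1 - z) -` N" "?r holomorphic_on (\<lambda>z. 1 - z) -` M"
    using N(2) M(2) by (auto intro!: holomorphic_intros)
  \<comment> \<open>The inner argument is a product of functions of a single variable.\<close>
  have "holomorphic2_on (\<lambda>p. u (?r (fst p) * ?r (snd p))) ?W"
    by (rule holomorphic2_on_compose[OF holomorphic2_on_mult[OF fst1[OF r(1)] snd1[OF r(2)]] T(2,1)])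
      (auto simp: pullback_domain_def)
  then have "holomorphic2_on
      (\<lambda>p. f (1 - fst p) * g (1 - snd p) * u (?r (fst p) * ?r (snd p))) ?W"
    by (intro holomorphic2_on_mult fst1[OF f] snd1[OF g])
  then show ?thesis
    by (simp add: twisted_pullback_def case_prod_unfold)
qed

section \<open>Solutions of Appell's system from Gauss's equation\<close>

theorem proposition1p5:
  fixes a b b' x\<^sub>0 y\<^sub>0 :: complex and f g :: "complex \<Rightarrow> complex"
  assumes "x\<^sub>0 * y\<^sub>0 * (1 - x\<^sub>0) * (1 - y\<^sub>0) * (1 - x\<^sub>0 - y\<^sub>0) \<noteq> 0"
    and "power_branch_at (- b) (1 - x\<^sub>0) f"
    and "power_branch_at (- b') (1 - y\<^sub>0) g"
  shows "(\<lambda>u. \<lambda>(x, y). f (1 - x) * g (1 - y) * u (x * y / ((1 - x) * (1 - y))))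
           ` gauss_solutions b b' a (x\<^sub>0 * y\<^sub>0 / ((1 - x\<^sub>0) * (1 - y\<^sub>0)))
         \<subseteq> appell2_solutions a b b' a a (x\<^sub>0, y\<^sub>0)"
proof (rule image_subsetI, fold twisted_pullback_def)
  fix u assume "u \<in> gauss_solutions b b' a (x\<^sub>0 * y\<^sub>0 / ((1 - x\<^sub>0) * (1 - y\<^sub>0)))"
  then obtain T where T: "open T" "u holomorphic_on T"
    and t0: "x\<^sub>0 * y\<^sub>0 / ((1 - x\<^sub>0) * (1 - y\<^sub>0)) \<in> T"
    and T01: "T \<subseteq> - {0, 1}" and sol: "\<And>t. t \<in> T \<Longrightarrow> gauss_op b b' a u t = 0"
    unfolding gauss_solutions_def by blast
  obtain N where N: "1 - x\<^sub>0 \<in> N" "power_like_on (- b) N f"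
    using power_branch_at_imp_power_like_on[OF assms(2)] .
  obtain M where M: "1 - y\<^sub>0 \<in> M" "power_like_on (- b') M g"
    using power_branch_at_imp_power_like_on[OF assms(3)] .
  have N0: "open N" "0 \<notin> N" and M0: "open M" "0 \<notin> M"
    using N(2) M(2) by (auto simp: power_like_on_def)
  let ?W = "pullback_domain N M T" and ?F = "twisted_pullback f g u"
  have "open ?W"
    using N0 M0 T by (intro open_pullback_domain)
  moreover have "(x\<^sub>0, y\<^sub>0) \<in> ?W"
    using N(1) M(1) t0 by (simp add: pullback_domain_def)
  moreover have "?W \<subseteq> appell_regular"
  proof
    fix p assume "p \<in> ?W"
    then obtain x y where p: "p = (x, y)" and nz: "1 - x \<noteq> 0" "1 - y \<noteq> 0"
      and t: "x * y / ((1 - x) * (1 - y)) \<notin> {0, 1}"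
      using N0(2) M0(2) T01 by (fastforce simp: pullback_domain_def)
    \<comment> \<open>The singular line \<open>1 - x - y = 0\<close> is the fibre over \<open>t = 1\<close>.\<close>
    have "1 - x - y \<noteq> 0"
    proof
      assume "1 - x - y = 0"
      then have "x * y = (1 - x) * (1 - y)" by (simp add: algebra_simps)
      with t nz show False by simp
    qed
    with nz t show "p \<in> appell_regular"
      by (auto simp: appell_regular_def p)
  qed
  moreover have "holomorphic2_on ?F ?W"
    using holomorphic2_on_twisted_pullback[OF N0 power_like_on_holomorphic[OF N(2)]
        M0 power_like_on_holomorphic[OF M(2)] T] .
  moreover have "appell_P2 a b a ?F p = 0 \<and> appell_Q2 a b' a ?F p = 0" if "p \<in> ?W" for p
  proof -
    obtain x y where p: "p = (x, y)" by fastforce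
    have "twisted_pullback f g (gauss_op b b' a u) p = 0"
      using that sol by (auto simp: twisted_pullback_def pullback_domain_def)
    then show ?thesis
      using appell_P2_twisted_pullback[OF N(2) M(2) T] appell_Q2_twisted_pullback[OF N(2) M(2) T]
        that unfolding p by auto
  qed
  ultimately show "?F \<in> appell2_solutions a b b' a a (x\<^sub>0, y\<^sub>0)"
    unfolding appell2_solutions_def by blast
qed

end
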